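(* Let $X$ be a Banach space, and let $A\subseteq X$ be a nonempty bounded set. If $A$ is uniquely remotal and M-compact, and the derived set $A'$ is compact, then $A$ is a singleton.
   Context: For a nonempty bounded subset $A$ of a normed linear space $X$ and $x\in X$, put $D(x,A)=\sup_{a\in A}\|x-a\|$ and $F(x,A)=\{a\in A:\|x-a\|=D(x,A)\}$. The set $A$ is called uniquely remotal if $F(x,A)$ consists of exactly one point for every $x\in X$. A sequence $\{a_n\}$ in $A$ is called maximizing (in $A$) if there is some $x\in X$ with $\|x-a_n\|\to D(x,A)$ as $n\to\infty$. The set $A$ is called M-compact if every maximizing sequence in $A$ has a subsequence converging to an element of $A$. The derived set $A'$ is the set of all limit (accumulation) points of $A$ in $X$. *)

theory Defs
  imports "HOL-Analysis.Analysis"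
begin

text \<open>All notions below are meant for nonempty bounded sets \<open>A\<close>. Only then is the
  (conditionally complete) supremum in \<open>farthest_dist\<close> the genuine one.\<close>

definition farthest_dist :: "'a::real_normed_vector \<Rightarrow> 'a set \<Rightarrow> real" where
  "farthest_dist x A = (SUP a\<in>A. norm (x - a))"

definition farthest_points :: "'a::real_normed_vector \<Rightarrow> 'a set \<Rightarrow> 'a set" where
  "farthest_points x A = {a \<in> A. norm (x - a) = farthest_dist x A}"

definition uniquely_remotal :: "'a::real_normed_vector set \<Rightarrow> bool" where
  "uniquely_remotal A \<longleftrightarrow> (\<forall>x. \<exists>!a. a \<in> farthest_points x A)"

definition maximizing_seq :: "'a::real_normed_vector set \<Rightarrow> (nat \<Rightarrow> 'a) \<Rightarrow> bool" where
  "maximizing_seq A s \<longleftrightarrow>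
     (\<forall>n. s n \<in> A) \<and> (\<exists>x. (\<lambda>n. norm (x - s n)) \<longlonglongrightarrow> farthest_dist x A)"

definition M_compact :: "'a::real_normed_vector set \<Rightarrow> bool" where
  "M_compact A \<longleftrightarrow>
     (\<forall>s. maximizing_seq A s \<longrightarrow> (\<exists>l\<in>A. \<exists>r. strict_mono r \<and> (s \<circ> r) \<longlonglongrightarrow> l))"

end

theory Submission
  imports Defs
begin

text \<open>Let \<open>D\<close> be the farthest distance of \<open>A\<close> and \<open>q\<close> the map that sends \<open>x\<close> to its unique farthest
  point. If \<open>y\<close> converges to \<open>x\<close>, then \<open>q y\<close> runs through a maximizing sequence for \<open>x\<close>, and
  M-compactness together with uniqueness forces \<open>q y\<close> to converge to \<open>q x\<close>
  (\<open>farthest_map_continuous\<close>). So the range of \<open>q\<close> is connected. If it is a point \<open>a\<close>, then \<open>a\<close>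
  is farthest from itself and \<open>A = {a}\<close>. Otherwise a connected set with more than one point has no
  isolated points, so the range of \<open>q\<close> lies in the compact set \<open>A'\<close>.

  One could now look for a fixed point of \<open>q\<close> with Schauder's theorem, because \<open>q x = x\<close> means
  \<open>D x = 0\<close>. A minimization of \<open>D\<close> does the same work in an elementary way. A continuous \<open>q\<close> makes
  \<open>D\<close> decrease from \<open>x\<close> toward \<open>q x\<close> if \<open>D x > 0\<close>: for \<open>z\<close> on this segment near \<open>x\<close>, the
  point of \<open>A\<close> farthest from \<open>z\<close> is still near \<open>q x\<close>, which \<open>z\<close> has approached. The descent
  survives an error of size \<open>\<epsilon> < D x\<close> in the endpoint \<open>q x\<close> (\<open>farthest_dist_descent\<close>). Take a
  finite \<open>\<epsilon>\<close>-net \<open>N\<close> of \<open>A'\<close> and minimize \<open>D\<close> over the compact polytope spanned by \<open>N\<close>. At a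
  minimizer with \<open>D x > \<epsilon>\<close>, moving toward the net point near \<open>q x\<close> would stay in the polytope and
  lower \<open>D\<close>. Hence \<open>D x \<le> \<epsilon>\<close>, so \<open>A\<close> has diameter at most \<open>2 * \<epsilon>\<close>, for every \<open>\<epsilon> > 0\<close>.\<close>

lemma norm_diff_le_farthest_dist:
  assumes "bounded A" and "a \<in> A"
  shows "norm (x - a) \<le> farthest_dist x A"
proof -
  obtain B where B: "\<And>a. a \<in> A \<Longrightarrow> norm a \<le> B"
    using \<open>bounded A\<close> by (auto simp: bounded_iff)
  have "bdd_above ((\<lambda>a. norm (x - a)) ` A)"
  proof (rule bdd_aboveI2)
    fix a assume "a \<in> A"
    then show "norm (x - a) \<le> norm x + B"
      using B[of a] norm_triangle_ineq4[of x a] by linarith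
  qed
  then show ?thesis
    using \<open>a \<in> A\<close> unfolding farthest_dist_def by (rule cSUP_upper[rotated])
qed

lemma farthest_dist_lipschitz:
  assumes "A \<noteq> {}" and "bounded A"
  shows "farthest_dist x A \<le> farthest_dist y A + norm (x - y)"
  unfolding farthest_dist_def[of x]
proof (rule cSUP_least[OF \<open>A \<noteq> {}\<close>])
  fix a assume "a \<in> A"
  then show "norm (x - a) \<le> farthest_dist y A + norm (x - y)"
    using norm_diff_le_farthest_dist[OF \<open>bounded A\<close>, of a y]
      norm_triangle_ineq[of "x - y" "y - a"] by simp
qed

lemma continuous_on_farthest_dist:
  assumes "A \<noteq> {}" and "bounded A"
  shows "continuous_on S (\<lambda>x. farthest_dist x A)"
proof -
  have "dist (farthest_dist x A) (farthest_dist y A) \<le> dist x y" for x y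
    using farthest_dist_lipschitz[OF assms, of x y] farthest_dist_lipschitz[OF assms, of y x]
    by (simp add: dist_norm abs_le_iff norm_minus_commute)
  then show ?thesis
    unfolding continuous_on_iff using le_less_trans by blast
qed

text \<open>If \<open>q\<close> jumps at \<open>x\<close>, there are \<open>y n\<close> tending to \<open>x\<close> whose farthest points stay away from
  \<open>q x\<close>. These farthest points maximize the distance from \<open>x\<close>, so some of them accumulate at a
  farthest point of \<open>x\<close>, which uniqueness identifies with \<open>q x\<close>.\<close>

lemma farthest_map_continuous:
  fixes A :: "'a::real_normed_vector set"
  assumes "A \<noteq> {}" and bdd: "bounded A" and "M_compact A"
    and q: "\<And>x. farthest_points x A = {q x}"
  shows "continuous_on UNIV q"
proof (rule ccontr)
  assume "\<not> continuous_on UNIV q"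
  then obtain x e where "e > 0" and far: "\<And>d. d > 0 \<Longrightarrow> \<exists>y. dist y x < d \<and> e \<le> dist (q y) (q x)"
    unfolding continuous_on_iff not_less by (meson UNIV_I not_less)
  have "\<exists>y. dist y x < inverse (real (Suc n)) \<and> e \<le> dist (q y) (q x)" for n
    by (rule far) simp
  then obtain y where y: "\<And>n. dist (y n) x < inverse (real (Suc n))"
    and y_far: "\<And>n. e \<le> dist (q (y n)) (q x)"
    by metis
  have qA: "q z \<in> A" and qD: "norm (z - q z) = farthest_dist z A" for z
    using q[of z] by (auto simp: farthest_points_def)
  have y_lim: "y \<longlonglongrightarrow> x"
  proof (rule metric_LIMSEQ_I)
    fix d :: real assume "d > 0"
    then obtain N where "inverse (real (Suc N)) < d"
      using reals_Archimedean by blast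
    moreover have "inverse (real (Suc n)) \<le> inverse (real (Suc N))" if "N \<le> n" for n
      using that by (simp add: le_imp_inverse_le)
    ultimately have "dist (y n) x < d" if "N \<le> n" for n
      using less_trans[OF less_le_trans[OF y[of n]]] that by blast
    then show "\<exists>N. \<forall>n\<ge>N. dist (y n) x < d"
      by blast
  qed
  have lim: "(\<lambda>n. norm (x - q (y n))) \<longlonglongrightarrow> farthest_dist x A"
  proof (rule tendsto_sandwich)
    show "\<forall>\<^sub>F n in sequentially. farthest_dist (y n) A - norm (x - y n) \<le> norm (x - q (y n))"
      using norm_triangle_ineq4[of "x - q (y n)" "x - y n" for n]
      by (intro always_eventually) (simp add: algebra_simps flip: qD)
    show "\<forall>\<^sub>F n in sequentially. norm (x - q (y n)) \<le> farthest_dist x A"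
      using norm_diff_le_farthest_dist[OF bdd qA] by simp
    have "(\<lambda>n. farthest_dist (y n) A) \<longlonglongrightarrow> farthest_dist x A"
      by (rule continuous_on_tendsto_compose[OF continuous_on_farthest_dist[OF \<open>A \<noteq> {}\<close> bdd, of UNIV] y_lim])
        simp_all
    moreover have "(\<lambda>n. norm (x - y n)) \<longlonglongrightarrow> norm (x - x)"
      by (intro tendsto_intros y_lim)
    ultimately show "(\<lambda>n. farthest_dist (y n) A - norm (x - y n)) \<longlonglongrightarrow> farthest_dist x A"
      using tendsto_diff by fastforce
  qed simp
  then have "maximizing_seq A (\<lambda>n. q (y n))"
    using qA by (auto simp: maximizing_seq_def)
  then obtain l r where "l \<in> A" and r: "strict_mono r" and l: "(\<lambda>n. q (y (r n))) \<longlonglongrightarrow> l"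
    using \<open>M_compact A\<close> unfolding M_compact_def o_def by blast
  have "(\<lambda>n. norm (x - q (y (r n)))) \<longlonglongrightarrow> norm (x - l)"
    by (intro tendsto_intros l)
  moreover have "(\<lambda>n. norm (x - q (y (r n)))) \<longlonglongrightarrow> farthest_dist x A"
    using LIMSEQ_subseq_LIMSEQ[OF lim r] by (simp add: o_def)
  ultimately have "norm (x - l) = farthest_dist x A"
    by (rule LIMSEQ_unique)
  with \<open>l \<in> A\<close> have "l = q x"
    using q[of x] by (auto simp: farthest_points_def)
  then have "(\<lambda>n. dist (q (y (r n))) (q x)) \<longlonglongrightarrow> 0"
    using l by (simp flip: tendsto_dist_iff)
  then have "e \<le> 0"
    using y_far by (intro LIMSEQ_le_const) auto
  with \<open>e > 0\<close> show False by simp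
qed

text \<open>For \<open>z = (1 - t) x + t p\<close> and \<open>a = q z\<close>, the difference \<open>z - a\<close> is the convex combination of
  \<open>x - a\<close>, of norm at most \<open>D x\<close>, and \<open>p - a\<close>. By continuity \<open>a\<close> is near \<open>q x\<close> for small \<open>t\<close>, so
  \<open>p - a\<close> is strictly shorter than \<open>D x\<close> as soon as \<open>p - q x\<close> is.\<close>

lemma farthest_dist_descent:
  fixes A :: "'a::real_normed_vector set"
  assumes bdd: "bounded A" and q: "\<And>x. q x \<in> farthest_points x A" and cont: "isCont q x"
    and near: "norm (p - q x) < farthest_dist x A"
  shows "\<exists>t\<in>{0<..<1}. farthest_dist ((1 - t) *\<^sub>R x + t *\<^sub>R p) A < farthest_dist x A"
proof -
  define z where "z t = (1 - t) *\<^sub>R x + t *\<^sub>R p" for t :: real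
  have qA: "q u \<in> A" and qD: "norm (u - q u) = farthest_dist u A" for u
    using q[of u] by (auto simp: farthest_points_def)
  have "(z \<longlongrightarrow> (1 - 0) *\<^sub>R x + 0 *\<^sub>R p) (at_right 0)"
    unfolding z_def by (intro tendsto_intros)
  then have "(z \<longlongrightarrow> x) (at_right 0)"
    by simp
  then have "((\<lambda>t. q (z t)) \<longlongrightarrow> q x) (at_right 0)"
    by (rule isCont_tendsto_compose[OF cont])
  then have "((\<lambda>t. norm (p - q (z t))) \<longlongrightarrow> norm (p - q x)) (at_right 0)"
    by (intro tendsto_intros)
  then have "\<forall>\<^sub>F t in at_right 0. norm (p - q (z t)) < farthest_dist x A"
    using near by (rule order_tendstoD)
  moreover have "\<forall>\<^sub>F t in at_right (0::real). t \<in> {0<..<1}"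
    by (rule eventually_at_right_real) simp
  ultimately have "\<forall>\<^sub>F t in at_right 0. t \<in> {0<..<1} \<and> norm (p - q (z t)) < farthest_dist x A"
    by eventually_elim simp
  then obtain t where t: "t \<in> {0<..<1}" and pt: "norm (p - q (z t)) < farthest_dist x A"
    using eventually_happens trivial_limit_at_right_real by blast
  have "z t - q (z t) = (1 - t) *\<^sub>R (x - q (z t)) + t *\<^sub>R (p - q (z t))"
    by (simp add: z_def algebra_simps)
  then have "farthest_dist (z t) A \<le> (1 - t) * norm (x - q (z t)) + t * norm (p - q (z t))"
    using norm_triangle_ineq[of "(1 - t) *\<^sub>R (x - q (z t))" "t *\<^sub>R (p - q (z t))"] t
    by (simp flip: qD)
  also have "\<dots> < (1 - t) * farthest_dist x A + t * farthest_dist x A"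
    using t pt norm_diff_le_farthest_dist[OF bdd qA]
    by (intro add_le_less_mono mult_left_mono mult_strict_left_mono) auto
  finally show ?thesis
    using t by (auto simp: z_def algebra_simps)
qed

text \<open>The polytope spanned by a finite net stands in for the closed convex hull of \<open>C\<close>. It is
  compact in every normed space, and it contains the segment from a minimizer to a net point. The
  price is the error \<open>e\<close> in the target of the descent.\<close>

lemma farthest_dist_small_if_range_precompact:
  fixes A :: "'a::real_normed_vector set"
  assumes "A \<noteq> {}" and bdd: "bounded A" and q: "\<And>x. q x \<in> farthest_points x A"
    and cont: "continuous_on UNIV q" and "range q \<subseteq> C" and "compact C" and "e > 0"
  shows "\<exists>x. farthest_dist x A \<le> e"
proof -
  obtain N where N: "finite N" "C \<subseteq> (\<Union>p\<in>N. ball p e)"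
    using seq_compact_imp_totally_bounded[OF compact_imp_seq_compact[OF \<open>compact C\<close>]] \<open>e > 0\<close>
    by blast
  let ?K = "convex hull N"
  have "N \<noteq> {}"
    using N(2) \<open>range q \<subseteq> C\<close> by auto
  then have "?K \<noteq> {}" "compact ?K"
    using N(1) by (auto intro: finite_imp_compact_convex_hull)
  then obtain x where x: "x \<in> ?K" and xmin: "\<And>y. y \<in> ?K \<Longrightarrow> farthest_dist x A \<le> farthest_dist y A"
    using continuous_attains_inf[OF _ _ continuous_on_farthest_dist[OF \<open>A \<noteq> {}\<close> bdd], of ?K]
    by blast
  have "farthest_dist x A \<le> e"
  proof (rule ccontr)
    assume "\<not> farthest_dist x A \<le> e"
    moreover have "q x \<in> (\<Union>p\<in>N. ball p e)"
      using N(2) \<open>range q \<subseteq> C\<close> by blast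
    then obtain p where "p \<in> N" "norm (p - q x) < e"
      by (auto simp: dist_norm)
    ultimately obtain t where t: "t \<in> {0<..<1}"
      and less: "farthest_dist ((1 - t) *\<^sub>R x + t *\<^sub>R p) A < farthest_dist x A"
      using farthest_dist_descent[OF bdd q, of x p] cont
      by (auto simp: continuous_on_eq_continuous_at)
    have "(1 - t) *\<^sub>R x + t *\<^sub>R p \<in> ?K"
      using t x hull_inc[OF \<open>p \<in> N\<close>] by (intro convexD[OF convex_convex_hull]) auto
    then show False
      using xmin less by fastforce
  qed
  then show ?thesis ..
qed

theorem theorem2p6:
  fixes A :: "'a::banach set"
  assumes "A \<noteq> {}" and "bounded A"
    and "uniquely_remotal A" and "M_compact A"
    and "compact {x. x islimpt A}"
  shows "\<exists>a. A = {a}"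
proof -
  have "\<forall>x. \<exists>a. farthest_points x A = {a}"
    using \<open>uniquely_remotal A\<close> unfolding uniquely_remotal_def by blast
  then obtain q where q: "\<And>x. farthest_points x A = {q x}"
    by metis
  have qA: "q x \<in> A" and qD: "norm (x - q x) = farthest_dist x A" for x
    using q[of x] by (auto simp: farthest_points_def)
  have le: "norm (x - a) \<le> farthest_dist x A" if "a \<in> A" for x a
    using norm_diff_le_farthest_dist[OF \<open>bounded A\<close> that] .
  have cont: "continuous_on UNIV q"
    using farthest_map_continuous[OF \<open>A \<noteq> {}\<close> \<open>bounded A\<close> \<open>M_compact A\<close> q] .
  show ?thesis
  proof (cases "\<exists>a. range q = {a}")
    case True
    then obtain a where a: "\<And>x. q x = a"
      by (metis rangeI singletonD)
    have "farthest_dist a A = 0"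
      using qD[of a] a by simp
    then have "A \<subseteq> {a}"
      using le[of _ a] by auto
    with \<open>A \<noteq> {}\<close> show ?thesis by auto
  next
    case False
    have "connected (range q)"
      using cont connected_UNIV by (rule connected_continuous_image)
    then have "x islimpt range q" if "x \<in> range q" for x
      using connected_imp_perfect[of "range q" x] that False by blast
    then have "range q \<subseteq> {x. x islimpt A}"
      using qA islimpt_subset[of _ "range q" A] by blast
    then have small: "\<exists>x. farthest_dist x A \<le> e" if "e > 0" for e
      using farthest_dist_small_if_range_precompact[OF \<open>A \<noteq> {}\<close> \<open>bounded A\<close> _ cont _ assms(5) that] q
      by blast
    have "a = b" if "a \<in> A" "b \<in> A" for a b
    proof (rule ccontr)
      assume "a \<noteq> b"
      then obtain x where "farthest_dist x A \<le> norm (a - b) / 3"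
        using small[of "norm (a - b) / 3"] by auto
      moreover have "norm (a - b) \<le> norm (x - b) + norm (x - a)"
        using norm_triangle_ineq4[of "x - b" "x - a"] by simp
      moreover have "norm (a - b) > 0"
        using \<open>a \<noteq> b\<close> by simp
      ultimately show False
        using le[OF that(1), of x] le[OF that(2), of x] by linarith
    qed
    with \<open>A \<noteq> {}\<close> show ?thesis by blast
  qed
qed

end
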